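(* Let $n\in\mathbb{N}$. For every edge $e$ of $S_{(n+1)\times n}$, Maker has a winning strategy for the $(1,1)$-crossing game on $S_{(n+1)\times n}$ in which her first move is to claim $e$.
   Context: $S_{m\times n}$ is the graph obtained from the grid graph on $\{(x,y):x\in[m],y\in[n]\}$ (edges between points at Euclidean distance $1$) by deleting all vertical edges with both endpoints having $x=1$ or both having $x=m$. A left-right crossing path joins some $(1,y)$ to some $(m,y')$. In the $(1,1)$-crossing game (Bridg-it), Maker and Breaker alternate turns, Maker first, each claiming one as-yet unclaimed edge per turn; Maker wins if she claims all edges of a left-right crossing path, Breaker wins if it becomes impossible for Maker ever to do so. *)

theory Defs
  imports "HOL-Analysis.Product_Vector"
begin

type_synonym point = "nat \<times> nat"
type_synonym edge = "point set"

definition grid_vertices :: "nat \<Rightarrow> nat \<Rightarrow> point set" where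
  "grid_vertices m n = {1..m} \<times> {1..n}"

text \<open>The metric on \<open>real \<times> real\<close> is the Euclidean one.\<close>

definition euclid_dist :: "point \<Rightarrow> point \<Rightarrow> real" where
  "euclid_dist u v = dist (real (fst u), real (snd u)) (real (fst v), real (snd v))"

definition grid_edges :: "nat \<Rightarrow> nat \<Rightarrow> edge set" where
  "grid_edges m n =
     {{u, v} | u v. u \<in> grid_vertices m n \<and> v \<in> grid_vertices m n \<and> euclid_dist u v = 1}"

text \<open>The graph \<open>S\<^bsub>m\<times>n\<^esub>\<close> has vertex set \<open>grid_vertices m n\<close> and the following edge set.\<close>

definition S_edges :: "nat \<Rightarrow> nat \<Rightarrow> edge set" where
  "S_edges m n = grid_edges m n - {{(x, y), (x, y')} | x y y'. x = 1 \<or> x = m}"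

definition path_edges :: "point list \<Rightarrow> edge set" where
  "path_edges p = {{p ! i, p ! Suc i} | i. Suc i < length p}"

definition crossing_path :: "nat \<Rightarrow> nat \<Rightarrow> point list \<Rightarrow> bool" where
  "crossing_path m n p \<longleftrightarrow>
     p \<noteq> [] \<and> distinct p \<and> set p \<subseteq> grid_vertices m n \<and> path_edges p \<subseteq> S_edges m n \<and>
     fst (hd p) = 1 \<and> fst (last p) = m"

text \<open>
  The course of the game is recorded as the list of edges claimed so far, in chronological
  order. Maker moves first, so her edges are those at the even (0-based) positions.
\<close>

definition claim_sequence :: "nat \<Rightarrow> nat \<Rightarrow> edge list \<Rightarrow> bool" where
  "claim_sequence m n h \<longleftrightarrow> distinct h \<and> set h \<subseteq> S_edges m n"

definition maker_edges :: "edge list \<Rightarrow> edge set" where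
  "maker_edges h = {h ! i | i. i < length h \<and> even i}"

definition maker_won :: "nat \<Rightarrow> nat \<Rightarrow> edge list \<Rightarrow> bool" where
  "maker_won m n h \<longleftrightarrow> (\<exists>p. crossing_path m n p \<and> path_edges p \<subseteq> maker_edges h)"

text \<open>Breaker has won once no continuation whatsoever leads to a win of Maker.\<close>

definition breaker_won :: "nat \<Rightarrow> nat \<Rightarrow> edge list \<Rightarrow> bool" where
  "breaker_won m n h \<longleftrightarrow> \<not> (\<exists>h'. claim_sequence m n (h @ h') \<and> maker_won m n (h @ h'))"

definition game_over :: "nat \<Rightarrow> nat \<Rightarrow> edge list \<Rightarrow> bool" where
  "game_over m n h \<longleftrightarrow> maker_won m n h \<or> breaker_won m n h"

definition play :: "nat \<Rightarrow> nat \<Rightarrow> edge list \<Rightarrow> bool" where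
  "play m n h \<longleftrightarrow> claim_sequence m n h \<and> (\<forall>i < length h. \<not> game_over m n (take i h))"

text \<open>A strategy of Maker maps each play in which it is her turn to the edge she claims next.\<close>

type_synonym strategy = "edge list \<Rightarrow> edge"

definition play_following :: "nat \<Rightarrow> nat \<Rightarrow> strategy \<Rightarrow> edge list \<Rightarrow> bool" where
  "play_following m n \<sigma> h \<longleftrightarrow>
     play m n h \<and> (\<forall>i < length h. even i \<longrightarrow> h ! i = \<sigma> (take i h))"

text \<open>
  Plays are finite, since each edge is claimed at most once, and a play in which all edges
  are claimed is over. So if the strategy always prescribes a legal move, every play following
  it runs until the game is over, and it suffices to demand that Maker has won by then.
\<close>

definition maker_winning_strategy :: "nat \<Rightarrow> nat \<Rightarrow> strategy \<Rightarrow> bool" where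
  "maker_winning_strategy m n \<sigma> \<longleftrightarrow>
     (\<forall>h. play_following m n \<sigma> h \<and> \<not> game_over m n h \<and> even (length h)
            \<longrightarrow> \<sigma> h \<in> S_edges m n - set h) \<and>
     (\<forall>h. play_following m n \<sigma> h \<and> game_over m n h \<longrightarrow> maker_won m n h)"

end

theory Submission imports Defs begin

text \<open>
  Add the deleted vertical edges of the first and last column (the rails) as free connections.
  Lehman's strategy for Maker: besides her own edges \<open>C\<close>, keep two disjoint sets \<open>A\<close>, \<open>B\<close> of unclaimed
  edges such that \<open>C \<union> A\<close> and \<open>C \<union> B\<close>, each with the rails, connect all vertices. When Breaker
  takes an edge whose loss disconnects one of the two graphs, Maker claims an edge of the other one
  that joins the two parts. Once all edges are claimed, Maker's edges and the rails connect
  everything, so Maker has a crossing path.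

  It remains to find \<open>A\<close> and \<open>B\<close> for \<open>C = {e}\<close>, which is done by induction on \<open>n\<close>: a suitable pair for
  the board of size \<open>k\<close>, placed in a corner, extends to the board of size \<open>k + 1\<close>, and every edge can
  be moved into the corner board by reflections, except for the single vertical edge when \<open>n = 2\<close>.
\<close>

section \<open>Edges of the board in coordinates\<close>

definition hedge :: "nat \<Rightarrow> nat \<Rightarrow> edge" where
  "hedge x y = {(x, y), (Suc x, y)}"

definition vedge :: "nat \<Rightarrow> nat \<Rightarrow> edge" where
  "vedge x y = {(x, y), (x, Suc y)}"

definition rails :: "nat \<Rightarrow> edge set" where
  "rails n = {vedge x y | x y. (x = 1 \<or> x = Suc n) \<and> 1 \<le> y \<and> y < n}"

lemma hedge_eq_iff [simp]: "hedge x y = hedge x' y' \<longleftrightarrow> x = x' \<and> y = y'"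
  by (auto simp: hedge_def doubleton_eq_iff)

lemma vedge_eq_iff [simp]: "vedge x y = vedge x' y' \<longleftrightarrow> x = x' \<and> y = y'"
  by (auto simp: vedge_def doubleton_eq_iff)

lemma hedge_neq_vedge [simp]: "hedge x y \<noteq> vedge x' y'" "vedge x' y' \<noteq> hedge x y"
  by (auto simp: hedge_def vedge_def doubleton_eq_iff)

text \<open>Two integer squares add up to 1 only if one is 0 and the other is 1. The differences are
  taken in \<open>int\<close> because subtraction of naturals truncates.\<close>

lemma euclid_dist_eq_1_iff:
  "euclid_dist (a, b) (c, d) = 1 \<longleftrightarrow>
     a = c \<and> (d = Suc b \<or> b = Suc d) \<or> b = d \<and> (c = Suc a \<or> a = Suc c)"
proof -
  define p q where "p = int a - int c" and "q = int b - int d"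
  have "euclid_dist (a, b) (c, d) = 1 \<longleftrightarrow> (real a - real c)\<^sup>2 + (real b - real d)\<^sup>2 = 1"
    by (simp add: euclid_dist_def dist_prod_def dist_real_def)
  also have "\<dots> \<longleftrightarrow> real_of_int (p\<^sup>2 + q\<^sup>2) = real_of_int 1"
    by (simp add: p_def q_def)
  also have "\<dots> \<longleftrightarrow> p\<^sup>2 + q\<^sup>2 = 1"
    by (simp only: of_int_eq_iff)
  also have "\<dots> \<longleftrightarrow> p = 0 \<and> \<bar>q\<bar> = 1 \<or> q = 0 \<and> \<bar>p\<bar> = 1"
  proof
    assume *: "p\<^sup>2 + q\<^sup>2 = 1"
    have "p\<^sup>2 \<ge> 0" "q\<^sup>2 \<ge> 0" by simp_all
    with * consider "p\<^sup>2 = 0" "q\<^sup>2 = 1" | "p\<^sup>2 = 1" "q\<^sup>2 = 0" by linarith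
    then show "p = 0 \<and> \<bar>q\<bar> = 1 \<or> q = 0 \<and> \<bar>p\<bar> = 1"
      by cases (auto simp: power2_eq_1_iff)
  next
    assume "p = 0 \<and> \<bar>q\<bar> = 1 \<or> q = 0 \<and> \<bar>p\<bar> = 1"
    then show "p\<^sup>2 + q\<^sup>2 = 1"
      by (auto simp: abs_eq_iff power2_eq_1_iff)
  qed
  also have "\<dots> \<longleftrightarrow> a = c \<and> (d = Suc b \<or> b = Suc d) \<or> b = d \<and> (c = Suc a \<or> a = Suc c)"
    unfolding p_def q_def by linarith
  finally show ?thesis .
qed

text \<open>Replaces the metric by coordinates: deleting the vertical edges of the outer columns
  leaves those in columns \<open>2\<close> to \<open>n\<close>. All later case distinctions on edges
  rest on this form.\<close>

lemma S_edges_eq: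
  "S_edges (Suc n) n =
     {hedge x y | x y. 1 \<le> x \<and> x \<le> n \<and> 1 \<le> y \<and> y \<le> n} \<union>
     {vedge x y | x y. 2 \<le> x \<and> x \<le> n \<and> 1 \<le> y \<and> y < n}" (is "?L = ?H \<union> ?W")
proof (intro equalityI subsetI)
  fix e assume e: "e \<in> ?L"
  then obtain a b c d where ab: "e = {(a, b), (c, d)}"
    and V: "(a, b) \<in> grid_vertices (Suc n) n" "(c, d) \<in> grid_vertices (Suc n) n"
    and D: "euclid_dist (a, b) (c, d) = 1"
    by (auto simp: S_edges_def grid_edges_def)
  have no: "\<not> (a = c \<and> (a = 1 \<or> a = n + 1))"
    using e ab by (auto simp: S_edges_def)
  from D consider "a = c" "d = Suc b" | "a = c" "b = Suc d" | "b = d" "c = Suc a" | "b = d" "a = Suc c"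
    by (auto simp: euclid_dist_eq_1_iff)
  then show "e \<in> ?H \<union> ?W"
  proof cases
    case 1
    then have "e = vedge a b" by (simp add: ab vedge_def)
    moreover have "2 \<le> a" "a \<le> n" "1 \<le> b" "b < n" using V no 1 by (auto simp: grid_vertices_def)
    ultimately show ?thesis by blast
  next
    case 2
    then have "e = vedge a d" by (simp add: ab vedge_def insert_commute)
    moreover have "2 \<le> a" "a \<le> n" "1 \<le> d" "d < n" using V no 2 by (auto simp: grid_vertices_def)
    ultimately show ?thesis by blast
  next
    case 3
    then have "e = hedge a b" by (simp add: ab hedge_def)
    moreover have "1 \<le> a" "a \<le> n" "1 \<le> b" "b \<le> n" using V 3 by (auto simp: grid_vertices_def)
    ultimately show ?thesis by blast
  next
    case 4
    then have "e = hedge c b" by (simp add: ab hedge_def insert_commute)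
    moreover have "1 \<le> c" "c \<le> n" "1 \<le> b" "b \<le> n" using V 4 by (auto simp: grid_vertices_def)
    ultimately show ?thesis by blast
  qed
next
  fix e assume "e \<in> ?H \<union> ?W"
  then consider x y where "e = hedge x y" "1 \<le> x" "x \<le> n" "1 \<le> y" "y \<le> n"
    | x y where "e = vedge x y" "2 \<le> x" "x \<le> n" "1 \<le> y" "y < n" by blast
  then show "e \<in> ?L"
  proof cases
    case 1
    have "e \<in> grid_edges (Suc n) n"
      unfolding grid_edges_def mem_Collect_eq 1(1) hedge_def
      by (rule exI[of _ "(x, y)"], rule exI[of _ "(Suc x, y)"])
        (use 1 in \<open>auto simp: grid_vertices_def euclid_dist_eq_1_iff\<close>)
    then show ?thesis by (auto simp: S_edges_def 1(1) hedge_def doubleton_eq_iff)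
  next
    case 2
    have "e \<in> grid_edges (Suc n) n"
      unfolding grid_edges_def mem_Collect_eq 2(1) vedge_def
      by (rule exI[of _ "(x, y)"], rule exI[of _ "(x, Suc y)"])
        (use 2 in \<open>auto simp: grid_vertices_def euclid_dist_eq_1_iff\<close>)
    then show ?thesis using 2 by (auto simp: S_edges_def 2(1) vedge_def doubleton_eq_iff)
  qed
qed

lemma hedge_in_S_edges_iff [simp]:
  "hedge x y \<in> S_edges (Suc n) n \<longleftrightarrow> 1 \<le> x \<and> x \<le> n \<and> 1 \<le> y \<and> y \<le> n"
  unfolding S_edges_eq by auto

lemma vedge_in_S_edges_iff [simp]:
  "vedge x y \<in> S_edges (Suc n) n \<longleftrightarrow> 2 \<le> x \<and> x \<le> n \<and> 1 \<le> y \<and> y < n"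
  unfolding S_edges_eq by auto

lemma vedge_in_rails_iff [simp]:
  "vedge x y \<in> rails n \<longleftrightarrow> (x = 1 \<or> x = Suc n) \<and> 1 \<le> y \<and> y < n"
  unfolding rails_def by auto

lemma S_edges_cases:
  assumes "e \<in> S_edges (Suc n) n"
  obtains (hedge) x y where "e = hedge x y" "1 \<le> x" "x \<le> n" "1 \<le> y" "y \<le> n"
    | (vedge) x y where "e = vedge x y" "2 \<le> x" "x \<le> n" "1 \<le> y" "y < n"
proof -
  from assms consider
    "e \<in> {hedge x y | x y. 1 \<le> x \<and> x \<le> n \<and> 1 \<le> y \<and> y \<le> n}"
    | "e \<in> {vedge x y | x y. 2 \<le> x \<and> x \<le> n \<and> 1 \<le> y \<and> y < n}"
    unfolding S_edges_eq by (elim UnE)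
  then show ?thesis using that by cases (elim CollectE exE conjE, simp only:)+
qed

lemma S_edges_subset_Pow: "S_edges m n \<subseteq> Pow (grid_vertices m n)"
  by (auto simp: S_edges_def grid_edges_def)

lemma finite_S_edges: "finite (S_edges m n)"
  by (rule finite_subset[OF S_edges_subset_Pow]) (simp add: grid_vertices_def)

section \<open>Connectivity and the exchange of edges\<close>

text \<open>Connectivity in terms of cuts: every 2-colouring that is constant along edges is constant.\<close>

definition connects :: "'a set \<Rightarrow> 'a set set \<Rightarrow> bool" where
  "connects V F \<longleftrightarrow>
     (\<forall>c :: 'a \<Rightarrow> bool. (\<forall>u v. {u, v} \<in> F \<longrightarrow> c u = c v) \<longrightarrow> (\<forall>u\<in>V. \<forall>v\<in>V. c u = c v))"

lemma connectsI:
  assumes "\<And>c :: 'a \<Rightarrow> bool. (\<And>u v. {u, v} \<in> F \<Longrightarrow> c u = c v) \<Longrightarrow> \<exists>k. \<forall>u\<in>V. c u = k"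
  shows "connects V F"
  unfolding connects_def
proof (intro allI impI ballI)
  fix c :: "'a \<Rightarrow> bool" and u v
  assume c: "\<forall>u v. {u, v} \<in> F \<longrightarrow> c u = c v" and uv: "u \<in> V" "v \<in> V"
  have "\<exists>k. \<forall>u\<in>V. c u = k" by (rule assms) (rule c[rule_format])
  then obtain k where "\<forall>u\<in>V. c u = k" ..
  with uv show "c u = c v" by simp
qed

lemma connectsD:
  fixes c :: "'a \<Rightarrow> bool"
  assumes "connects V F" "\<And>u v. {u, v} \<in> F \<Longrightarrow> c u = c v" "u \<in> V" "v \<in> V"
  shows "c u = c v"
  using assms(1)[unfolded connects_def, rule_format, of c, OF _ assms(3,4)] assms(2) .

lemma connects_cutE:
  fixes c :: "'a \<Rightarrow> bool"
  assumes "connects V F" "\<not> (\<forall>u\<in>V. \<forall>v\<in>V. c u = c v)"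
  obtains u v where "{u, v} \<in> F" "c u \<noteq> c v"
proof (rule ccontr)
  assume "\<not> thesis"
  then have "c u = c v" if "{u, v} \<in> F" for u v
    using that \<open>\<And>v u. {u, v} \<in> F \<Longrightarrow> c u \<noteq> c v \<Longrightarrow> thesis\<close> by (cases "c u = c v") simp_all
  with connectsD[OF assms(1)] assms(2) show False by simp
qed

lemma connects_mono:
  assumes "connects V F" "F \<subseteq> F'"
  shows "connects V F'"
  unfolding connects_def
proof (intro allI impI ballI)
  fix c :: "'a \<Rightarrow> bool" and u v
  assume c: "\<forall>u v. {u, v} \<in> F' \<longrightarrow> c u = c v" and uv: "u \<in> V" "v \<in> V"
  show "c u = c v"
    by (rule connectsD[OF assms(1) _ uv]) (rule c[rule_format, OF subsetD[OF assms(2)]])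
qed

text \<open>A colouring \<open>c\<close> that is constant along the image edges pulls back along
  \<open>f\<close> to one that is constant along \<open>F\<close>; as \<open>f\<close> maps onto
  \<open>V\<close>, the conclusion carries back to \<open>c\<close>.\<close>

lemma connects_image:
  assumes "connects V F" "f ` V = V"
  shows "connects V ((`) f ` F)"
proof (rule connectsI)
  fix c :: "'a \<Rightarrow> bool"
  assume c: "\<And>u v. {u, v} \<in> (`) f ` F \<Longrightarrow> c u = c v"
  have "c (f u) = c (f v)" if "u \<in> V" "v \<in> V" for u v
  proof (rule connectsD[OF assms(1) _ that, of "\<lambda>p. c (f p)"])
    fix u v assume "{u, v} \<in> F"
    then have "f ` {u, v} \<in> (`) f ` F" by (rule imageI)
    then show "c (f u) = c (f v)" by (intro c) simp
  qed
  then have "\<exists>k. \<forall>u\<in>f ` V. c u = k" by blast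
  then show "\<exists>k. \<forall>u\<in>V. c u = k" by (simp only: assms(2))
qed

text \<open>
  If deleting \<open>f\<close> disconnects \<open>F\<close>, the two resulting parts are separated by a colouring that is
  unique up to negation, so any edge of \<open>F'\<close> joining the parts repairs the damage.
\<close>

lemma connects_exchange:
  assumes F: "connects V F" and F': "connects V F'" and sub: "F' \<subseteq> Pow V"
    and broken: "\<not> connects V (F - {f})"
  obtains g where "g \<in> F'" "g \<notin> F - {f}" "connects V (insert g (F - {f}))"
proof -
  from broken obtain c :: "'a \<Rightarrow> bool" where
    "(\<forall>u v. {u, v} \<in> F - {f} \<longrightarrow> c u = c v) \<and> \<not> (\<forall>u\<in>V. \<forall>v\<in>V. c u = c v)"
    unfolding connects_def not_all not_imp ..
  then have c: "\<And>u v. {u, v} \<in> F - {f} \<Longrightarrow> c u = c v"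
    and nc: "\<not> (\<forall>u\<in>V. \<forall>v\<in>V. c u = c v)"
    by simp_all
  obtain u v where uv: "{u, v} \<in> F'" "c u \<noteq> c v"
    using F' nc by (rule connects_cutE)
  obtain a b where "{a, b} \<in> F" and ab': "c a \<noteq> c b"
    using F nc by (rule connects_cutE)
  \<comment> \<open>\<open>c\<close> is constant along every other edge of \<open>F\<close>, so the
    edge that it cuts must be \<open>f\<close>.\<close>
  with c[of a b] have ab: "f = {a, b}" "c a \<noteq> c b" by auto
  have uvV: "u \<in> V" "v \<in> V" using uv(1) sub by auto
  have "connects V (insert {u, v} (F - {f}))"
  proof (rule connectsI)
    fix d :: "'a \<Rightarrow> bool"
    assume d: "\<And>p q. {p, q} \<in> insert {u, v} (F - {f}) \<Longrightarrow> d p = d q"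
    show "\<exists>k. \<forall>p\<in>V. d p = k"
    proof (cases "d a = d b")
      case True
      have "d p = d q" if "{p, q} \<in> F" for p q
      proof (cases "{p, q} = f")
        case True
        then show ?thesis using \<open>d a = d b\<close> ab(1) by (auto simp: doubleton_eq_iff)
      qed (use that d[of p q] in simp)
      then have "d p = d u" if "p \<in> V" for p
        by (rule connectsD[OF F _ that uvV(1)])
      then show ?thesis by blast
    next
      case False
      \<comment> \<open>The auxiliary colouring records where \<open>c\<close> and \<open>d\<close>
        agree. It is constant along the edges that both respect, and also along \<open>f\<close>,
        where both change.\<close>
      have "(c p = d p) = (c q = d q)" if "{p, q} \<in> F" for p q
      proof (cases "{p, q} = f")
        case True
        then show ?thesis using False ab by (auto simp: doubleton_eq_iff)
      next
        case False
        then show ?thesis using that d[of p q] c[of p q] by simp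
      qed
      then have "(c u = d u) = (c v = d v)"
        by (rule connectsD[OF F _ uvV])
      moreover have "d u = d v" by (rule d) simp
      ultimately show ?thesis using uv(2) by auto
    qed
  qed
  moreover have "{u, v} \<notin> F - {f}" using c[of u v] uv(2) by auto
  ultimately show ?thesis using that[of "{u, v}"] uv(1) by simp
qed

section \<open>Pairs of disjoint connecting sets and their symmetries\<close>

text \<open>The invariant of Lehman's strategy, with \<open>C\<close> for Maker's edges and
  \<open>X\<close> for the unclaimed ones. Connecting sets are used instead of spanning trees, so
  cycles need no attention.\<close>

definition double_link :: "nat \<Rightarrow> edge set \<Rightarrow> edge set \<Rightarrow> bool" where
  "double_link n C X \<longleftrightarrow> (\<exists>A B. A \<inter> B = {} \<and> A \<subseteq> X \<and> B \<subseteq> X \<and>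
     connects (grid_vertices (Suc n) n) (C \<union> A \<union> rails n) \<and>
     connects (grid_vertices (Suc n) n) (C \<union> B \<union> rails n))"

lemma double_linkI:
  assumes "A \<inter> B = {}" "A \<subseteq> X" "B \<subseteq> X"
     "connects (grid_vertices (Suc n) n) (C \<union> A \<union> rails n)"
     "connects (grid_vertices (Suc n) n) (C \<union> B \<union> rails n)"
  shows "double_link n C X"
  using assms unfolding double_link_def by blast

lemma rails_subset_Pow: "rails n \<subseteq> Pow (grid_vertices (Suc n) n)"
  by (auto simp: rails_def vedge_def grid_vertices_def)

text \<open>A symmetry of the board that preserves the rails carries a pair for \<open>e\<close> to
  a pair for the image of \<open>e\<close>.\<close>

lemma double_link_image:
  assumes "double_link n {e} (S_edges (Suc n) n - {e})" and e: "e \<in> S_edges (Suc n) n"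
    and V: "f ` grid_vertices (Suc n) n = grid_vertices (Suc n) n"
    and S: "\<And>d. d \<in> S_edges (Suc n) n \<Longrightarrow> f ` d \<in> S_edges (Suc n) n"
    and R: "\<And>d. d \<in> rails n \<Longrightarrow> f ` d \<in> rails n"
  shows "double_link n {f ` e} (S_edges (Suc n) n - {f ` e})"
proof -
  let ?V = "grid_vertices (Suc n) n" and ?S = "S_edges (Suc n) n" and ?f = "(`) f"
  obtain A B where AB: "A \<inter> B = {}" "A \<subseteq> ?S - {e}" "B \<subseteq> ?S - {e}"
     "connects ?V ({e} \<union> A \<union> rails n)" "connects ?V ({e} \<union> B \<union> rails n)"
    using assms(1) unfolding double_link_def by blast
  \<comment> \<open>A map of a finite set onto itself is injective. Hence so is its action on edges,
    which keeps the images of \<open>A\<close> and \<open>B\<close> disjoint and away from the image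
    of \<open>e\<close>.\<close>
  have "finite ?V" by (simp add: grid_vertices_def)
  then have "inj_on f ?V" using V by (simp add: eq_card_imp_inj_on)
  then have "inj_on ?f (Pow ?V)" by (rule inj_on_image_Pow)
  then have inj: "inj_on ?f ?S" by (rule inj_on_subset) (rule S_edges_subset_Pow)
  have conn: "connects ?V ({f ` e} \<union> ?f ` C \<union> rails n)" if "connects ?V ({e} \<union> C \<union> rails n)" for C
    by (rule connects_mono[OF connects_image[OF that V]]) (use R in auto)
  have sub: "?f ` C \<subseteq> ?S - {f ` e}" if "C \<subseteq> ?S - {e}" for C
    using that S e inj by (auto simp: inj_on_def)
  have "?f ` A \<inter> ?f ` B = {}"
    using inj_on_image_Int[OF inj, of A B] AB(1-3) by auto
  then show ?thesis
    using sub[OF AB(2)] sub[OF AB(3)] conn[OF AB(4)] conn[OF AB(5)] by (rule double_linkI)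
qed

lemma involution_image:
  assumes "\<And>p. p \<in> V \<Longrightarrow> f p \<in> V \<and> f (f p) = p"
  shows "f ` V = V"
proof
  show "f ` V \<subseteq> V" using assms by blast
  show "V \<subseteq> f ` V"
  proof
    fix p assume "p \<in> V"
    then have "p = f (f p)" "f p \<in> V" using assms by auto
    then show "p \<in> f ` V" by (rule image_eqI)
  qed
qed

text \<open>There are \<open>n + 1\<close> columns but \<open>n\<close> rows, both counted from 1;
  hence \<open>n + 2\<close> here and \<open>n + 1\<close> in \<open>reflect_y\<close>.\<close>

definition reflect_x :: "nat \<Rightarrow> point \<Rightarrow> point" where
  "reflect_x n = (\<lambda>(x, y). (n + 2 - x, y))"

definition reflect_y :: "nat \<Rightarrow> point \<Rightarrow> point" where
  "reflect_y n = (\<lambda>(x, y). (x, n + 1 - y))"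

text \<open>An edge is named by its left end, and reflection exchanges the ends: the new name comes
  from the old right end, \<open>n + 2 - (x + 1)\<close>. The same shift occurs in
  \<open>reflect_y_vedge\<close>.\<close>

lemma reflect_x_hedge: "x \<le> n \<Longrightarrow> reflect_x n ` hedge x y = hedge (n + 1 - x) y"
  by (auto simp: reflect_x_def hedge_def Suc_diff_le)

lemma reflect_x_vedge: "reflect_x n ` vedge x y = vedge (n + 2 - x) y"
  by (simp add: reflect_x_def vedge_def)

lemma reflect_y_hedge: "reflect_y n ` hedge x y = hedge x (n + 1 - y)"
  by (simp add: reflect_y_def hedge_def)

lemma reflect_y_vedge: "y < n \<Longrightarrow> reflect_y n ` vedge x y = vedge x (n - y)"
  by (auto simp: reflect_y_def vedge_def Suc_diff_le)

lemma double_link_reflect_x: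
  assumes "double_link n {e} (S_edges (Suc n) n - {e})" "e \<in> S_edges (Suc n) n"
  shows "double_link n {reflect_x n ` e} (S_edges (Suc n) n - {reflect_x n ` e})"
proof (rule double_link_image[OF assms])
  show "reflect_x n ` grid_vertices (Suc n) n = grid_vertices (Suc n) n"
    by (rule involution_image) (auto simp: grid_vertices_def reflect_x_def)
next
  fix d assume "d \<in> S_edges (Suc n) n"
  then show "reflect_x n ` d \<in> S_edges (Suc n) n"
    by (cases rule: S_edges_cases) (auto simp: reflect_x_hedge reflect_x_vedge)
next
  fix d assume "d \<in> rails n"
  then show "reflect_x n ` d \<in> rails n"
    by (auto simp: rails_def reflect_x_vedge)
qed

lemma double_link_reflect_y:
  assumes "double_link n {e} (S_edges (Suc n) n - {e})" "e \<in> S_edges (Suc n) n"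
  shows "double_link n {reflect_y n ` e} (S_edges (Suc n) n - {reflect_y n ` e})"
proof (rule double_link_image[OF assms])
  show "reflect_y n ` grid_vertices (Suc n) n = grid_vertices (Suc n) n"
    by (rule involution_image) (auto simp: grid_vertices_def reflect_y_def)
next
  fix d assume "d \<in> S_edges (Suc n) n"
  then show "reflect_y n ` d \<in> S_edges (Suc n) n"
    by (cases rule: S_edges_cases) (auto simp: reflect_y_hedge reflect_y_vedge)
next
  fix d assume "d \<in> rails n"
  then show "reflect_y n ` d \<in> rails n"
    by (auto simp: rails_def reflect_y_vedge)
qed

section \<open>Construction of the initial pair by enlarging the board\<close>

lemma eq_first_of_eq_Suc:
  fixes f :: "nat \<Rightarrow> 'a"
  assumes "\<And>i. a \<le> i \<Longrightarrow> i < b \<Longrightarrow> f i = f (Suc i)" "a \<le> i" "i \<le> b"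
  shows "f i = f a"
  using assms(2,3)
proof (induction i rule: dec_induct)
  case (step i)
  then show ?case using assms(1)[of i] by simp
qed simp

text \<open>The small board keeps its coordinates, in columns \<open>1\<close> to
  \<open>k + 1\<close> and rows \<open>1\<close> to \<open>k\<close>. Only row \<open>k + 1\<close>
  and column \<open>k + 2\<close> are new, and two disjoint sets \<open>NA\<close> and
  \<open>NB\<close> of edges outside the small board attach them.\<close>

lemma double_link_extend:
  assumes link: "double_link k {e} (S_edges (Suc k) k - {e})" and e: "e \<in> S_edges (Suc k) k"
  shows "double_link (Suc k) {e} (S_edges (Suc (Suc k)) (Suc k) - {e})"
proof -
  let ?m = "Suc k"
  let ?V = "grid_vertices (Suc k) k" and ?S = "S_edges (Suc k) k"
  let ?V' = "grid_vertices (Suc ?m) ?m" and ?S' = "S_edges (Suc ?m) ?m"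
  have k: "1 \<le> k" using e by (cases rule: S_edges_cases) auto
  obtain A B where AB: "A \<inter> B = {}" "A \<subseteq> ?S - {e}" "B \<subseteq> ?S - {e}"
     "connects ?V ({e} \<union> A \<union> rails k)" "connects ?V ({e} \<union> B \<union> rails k)"
    using link unfolding double_link_def by (elim exE conjE)
  txt \<open>
    The right rail of the small board, on column \<open>k + 1\<close>, is no longer free: that column is now
    joined together by its own vertical edges in \<open>A \<union> NA\<close> and by the new right rail in \<open>B \<union> NB\<close>.
  \<close>
  define NA where "NA = {vedge ?m y | y. 1 \<le> y \<and> y \<le> k} \<union> {hedge ?m ?m} \<union> {hedge x ?m | x. 1 \<le> x \<and> x < k}"
  define NB where "NB = {hedge ?m y | y. 1 \<le> y \<and> y \<le> k} \<union> {hedge k ?m} \<union> {vedge x k | x. 2 \<le> x \<and> x \<le> k}"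
  have disj: "NA \<inter> NB = {}" by (auto simp: NA_def NB_def)
  have sub: "NA \<subseteq> ?S'" "NB \<subseteq> ?S'" using k by (auto simp: NA_def NB_def)
  have old: "d \<in> ?S' \<and> d \<notin> NA \<and> d \<notin> NB" if "d \<in> ?S" for d
    using that by (cases rule: S_edges_cases) (auto simp: NA_def NB_def)
  have "(A \<union> NA) \<inter> (B \<union> NB) = {}" using AB(1-3) disj old by auto
  moreover have "A \<union> NA \<subseteq> ?S' - {e}" "B \<union> NB \<subseteq> ?S' - {e}"
    using AB(2,3) sub old e by auto
  moreover have "connects ?V' ({e} \<union> (A \<union> NA) \<union> rails ?m)"
  proof (rule connectsI)
    fix c :: "point \<Rightarrow> bool"
    assume c: "\<And>u v. {u, v} \<in> {e} \<union> (A \<union> NA) \<union> rails ?m \<Longrightarrow> c u = c v"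
    have ch: "c (x, y) = c (Suc x, y)" if "hedge x y \<in> NA" for x y
      by (rule c) (use that in \<open>simp add: hedge_def\<close>)
    have cv: "c (x, y) = c (x, Suc y)" if "vedge x y \<in> NA \<union> rails ?m" for x y
      by (rule c) (use that in \<open>auto simp: vedge_def\<close>)
    have column: "c (?m, y) = c (?m, Suc y)" if "1 \<le> y" "y \<le> k" for y
      by (rule cv) (use that in \<open>simp add: NA_def\<close>)
    have rail: "c (x, y) = c (x, Suc y)" if "x = 1 \<or> x = Suc ?m" "1 \<le> y" "y \<le> k" for x y
      by (rule cv) (use that in simp)
    have inner: "c (x, y) = c (1, 1)" if "1 \<le> x" "x \<le> ?m" "1 \<le> y" "y \<le> k" for x y
    proof (rule connectsD[OF AB(4)])
      fix u v assume "{u, v} \<in> {e} \<union> A \<union> rails k"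
      then consider "{u, v} \<in> {e} \<union> A" | "{u, v} \<in> rails k" by auto
      then show "c u = c v"
      proof cases
        case 1
        then show ?thesis by (intro c) auto
      next
        case 2
        then obtain x y where xy: "{u, v} = vedge x y" "x = 1 \<or> x = ?m" "1 \<le> y" "y < k"
          unfolding rails_def mem_Collect_eq by (elim exE conjE)
        have "c (x, y) = c (x, Suc y)"
          using xy(2)
        proof
          assume "x = 1"
          with xy show ?thesis by (intro rail) simp_all
        next
          assume "x = ?m"
          with xy show ?thesis by (simp only:) (intro column, simp_all)
        qed
        with xy(1) show ?thesis by (auto simp: vedge_def doubleton_eq_iff)
      qed
    qed (use that in \<open>auto simp: grid_vertices_def\<close>)
    \<comment> \<open>In this graph the new row, up to column \<open>k\<close>, hangs on the left
      rail by its horizontal edges.\<close>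
    have row: "c (x, ?m) = c (1, 1)" if "1 \<le> x" "x \<le> k" for x
    proof -
      have "c (x, ?m) = c (1, ?m)"
        by (rule eq_first_of_eq_Suc[where f = "\<lambda>x. c (x, ?m)" and b = k])
          (use that in \<open>auto intro!: ch simp: NA_def\<close>)
      then show ?thesis using rail[of 1 k] inner[of 1 k] k by simp
    qed
    have corner: "c (?m, ?m) = c (1, 1)" using column[of k] inner[of ?m k] k by simp
    \<comment> \<open>A single edge leads from the corner to the new last column, and the right rail
      joins the rest of that column.\<close>
    have "c (Suc ?m, ?m) = c (1, 1)" using ch[of ?m ?m] corner by (simp add: NA_def)
    moreover have right: "c (Suc ?m, y) = c (Suc ?m, 1)" if "1 \<le> y" "y \<le> ?m" for y
      by (rule eq_first_of_eq_Suc[where f = "\<lambda>y. c (Suc ?m, y)" and b = ?m]) (use that rail in auto)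
    ultimately have "c (Suc ?m, 1) = c (1, 1)" by (metis le_refl le_add1 plus_1_eq_Suc)
    then have right': "c (Suc ?m, y) = c (1, 1)" if "1 \<le> y" "y \<le> ?m" for y
      using right[of y] that by simp
    have all: "c (x, y) = c (1, 1)" if "1 \<le> x" "x \<le> Suc ?m" "1 \<le> y" "y \<le> ?m" for x y
      using that inner[of x y] row[of x] corner right'[of y]
      by (cases "x = Suc ?m"; cases "y = ?m"; cases "x = ?m") auto
    have "c u = c (1, 1)" if "u \<in> ?V'" for u
      using that all[of "fst u" "snd u"] by (auto simp: grid_vertices_def)
    then show "\<exists>b. \<forall>u\<in>?V'. c u = b" by (intro exI ballI)
  qed
  moreover have "connects ?V' ({e} \<union> (B \<union> NB) \<union> rails ?m)"
  proof (rule connectsI)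
    fix c :: "point \<Rightarrow> bool"
    assume c: "\<And>u v. {u, v} \<in> {e} \<union> (B \<union> NB) \<union> rails ?m \<Longrightarrow> c u = c v"
    have ch: "c (x, y) = c (Suc x, y)" if "hedge x y \<in> NB" for x y
      by (rule c) (use that in \<open>simp add: hedge_def\<close>)
    have cv: "c (x, y) = c (x, Suc y)" if "vedge x y \<in> NB \<union> rails ?m" for x y
      by (rule c) (use that in \<open>auto simp: vedge_def\<close>)
    have rail: "c (x, y) = c (x, Suc y)" if "x = 1 \<or> x = Suc ?m" "1 \<le> y" "y \<le> k" for x y
      by (rule cv) (use that in simp)
    have right: "c (Suc ?m, y) = c (Suc ?m, 1)" if "1 \<le> y" "y \<le> ?m" for y
      by (rule eq_first_of_eq_Suc[where f = "\<lambda>y. c (Suc ?m, y)" and b = ?m]) (use that rail in auto)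
    have column: "c (?m, y) = c (Suc ?m, 1)" if "1 \<le> y" "y \<le> k" for y
      using right[of y] ch[of ?m y] that by (simp add: NB_def)
    have inner: "c (x, y) = c (1, 1)" if "1 \<le> x" "x \<le> ?m" "1 \<le> y" "y \<le> k" for x y
    proof (rule connectsD[OF AB(5)])
      fix u v assume "{u, v} \<in> {e} \<union> B \<union> rails k"
      then consider "{u, v} \<in> {e} \<union> B" | "{u, v} \<in> rails k" by auto
      then show "c u = c v"
      proof cases
        case 1
        then show ?thesis by (intro c) auto
      next
        case 2
        then obtain x y where xy: "{u, v} = vedge x y" "x = 1 \<or> x = ?m" "1 \<le> y" "y < k"
          unfolding rails_def mem_Collect_eq by (elim exE conjE)
        have "c (x, y) = c (x, Suc y)"
          using xy(2)
        proof
          assume "x = 1"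
          with xy show ?thesis by (intro rail) simp_all
        next
          assume "x = ?m"
          with xy column[of y] column[of "Suc y"] show ?thesis by simp
        qed
        with xy(1) show ?thesis by (auto simp: vedge_def doubleton_eq_iff)
      qed
    qed (use that in \<open>auto simp: grid_vertices_def\<close>)
    have "c (Suc ?m, 1) = c (1, 1)" using column[of 1] inner[of ?m 1] k by simp
    then have right': "c (Suc ?m, y) = c (1, 1)" if "1 \<le> y" "y \<le> ?m" for y
      using right[of y] that by simp
    \<comment> \<open>Now each vertex of the new row hangs on the one below it, by a rail if
      \<open>x = 1\<close> and by \<open>NB\<close> otherwise.\<close>
    have row: "c (x, ?m) = c (1, 1)" if "1 \<le> x" "x \<le> k" for x
    proof -
      have "c (x, k) = c (x, ?m)" using that by (intro cv) (auto simp: NB_def)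
      then show ?thesis using inner[of x k] that k by simp
    qed
    \<comment> \<open>The vertical edge below the corner was spent on \<open>NA\<close>, so the
      corner is reached from its left neighbour.\<close>
    have corner: "c (?m, ?m) = c (1, 1)" using ch[of k ?m] row[of k] k by (simp add: NB_def)
    have all: "c (x, y) = c (1, 1)" if "1 \<le> x" "x \<le> Suc ?m" "1 \<le> y" "y \<le> ?m" for x y
      using that inner[of x y] row[of x] corner right'[of y]
      by (cases "x = Suc ?m"; cases "y = ?m"; cases "x = ?m") auto
    have "c u = c (1, 1)" if "u \<in> ?V'" for u
      using that all[of "fst u" "snd u"] by (auto simp: grid_vertices_def)
    then show "\<exists>b. \<forall>u\<in>?V'. c u = b" by (intro exI ballI)
  qed
  ultimately show ?thesis by (rule double_linkI)
qed

text \<open>The only edge of this board already connects it, so both sets may be empty.\<close>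

lemma double_link_1: "double_link 1 {hedge 1 1} (S_edges 2 1 - {hedge 1 1})"
proof -
  have "connects (grid_vertices (Suc 1) 1) ({hedge 1 1} \<union> {} \<union> rails 1)"
  proof (rule connectsI)
    fix c :: "point \<Rightarrow> bool"
    assume c: "\<And>u v. {u, v} \<in> {hedge 1 1} \<union> {} \<union> rails 1 \<Longrightarrow> c u = c v"
    have "c (Suc 1, 1) = c (1, 1)" by (rule c[symmetric]) (simp add: hedge_def)
    then have "\<forall>u\<in>{1, Suc 1} \<times> {1}. c u = c (1, 1)" by simp
    moreover have "grid_vertices (Suc 1) 1 = {1, Suc 1} \<times> {1}" by (auto simp: grid_vertices_def)
    ultimately show "\<exists>k. \<forall>u\<in>grid_vertices (Suc 1) 1. c u = k" by (intro exI) simp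
  qed
  then show ?thesis by (intro double_linkI[of "{}" "{}"]) auto
qed

text \<open>With the vertical edge claimed, all three columns are connected inside. Each set then
  needs one horizontal edge per gap, and the four horizontal edges split into two such
  pairs.\<close>

lemma double_link_2: "double_link 2 {vedge 2 1} (S_edges 3 2 - {vedge 2 1})"
proof (rule double_linkI)
  have V: "grid_vertices (Suc 2) 2 = {1, 2, 3} \<times> {1, 2}" by (auto simp: grid_vertices_def)
  have S: "d \<in> S_edges 3 2" if "d \<in> {hedge 1 1, hedge 2 2, hedge 1 2, hedge 2 1}" for d
    using that hedge_in_S_edges_iff[of _ _ 2] by auto
  show "{hedge 1 1, hedge 2 2} \<inter> {hedge 1 2, hedge 2 1} = {}" by simp
  show "{hedge 1 1, hedge 2 2} \<subseteq> S_edges 3 2 - {vedge 2 1}"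
    "{hedge 1 2, hedge 2 1} \<subseteq> S_edges 3 2 - {vedge 2 1}" using S by simp_all
  have conn: "connects (grid_vertices (Suc 2) 2) ({vedge 2 1} \<union> {hedge 1 a, hedge 2 b} \<union> rails 2)"
    if "a \<in> {1, 2}" "b \<in> {1, 2}" for a b
  proof (rule connectsI)
    fix c :: "point \<Rightarrow> bool"
    assume c: "\<And>u v. {u, v} \<in> {vedge 2 1} \<union> {hedge 1 a, hedge 2 b} \<union> rails 2 \<Longrightarrow> c u = c v"
    have v: "c (x, y) = c (x, 1)" if "x \<in> {1, 2, 3}" "y \<in> {1, 2}" for x y
    proof -
      have "{(x, 1), (x, 2)} = vedge x 1" by (simp add: vedge_def numeral_2_eq_2)
      then have "c (x, 1) = c (x, 2)" using that(1) by (intro c) auto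
      then show ?thesis using that(2) by auto
    qed
    have "c (1, a) = c (2, a)" by (rule c) (simp add: hedge_def numeral_2_eq_2)
    then have 12: "c (2, 1) = c (1, 1)" using v[of 1 a] v[of 2 a] that by simp
    have "c (2, b) = c (3, b)" by (rule c) (simp add: hedge_def numeral_2_eq_2 numeral_3_eq_3)
    then have 23: "c (3, 1) = c (1, 1)" using v[of 2 b] v[of 3 b] that 12 by simp
    have "c (x, y) = c (1, 1)" if "x \<in> {1, 2, 3}" "y \<in> {1, 2}" for x y
      unfolding v[OF that] using that(1) by (elim insertE) (simp_all only: 12 23 empty_iff)
    then have "\<forall>u\<in>{1, 2, 3} \<times> {1, 2}. c u = c (1, 1)" by (intro ballI) (elim SigmaE, simp only:)
    then show "\<exists>k. \<forall>u\<in>grid_vertices (Suc 2) 2. c u = k" unfolding V by (intro exI)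
  qed
  show "connects (grid_vertices (Suc 2) 2) ({vedge 2 1} \<union> {hedge 1 1, hedge 2 2} \<union> rails 2)"
    by (rule conn) simp_all
  show "connects (grid_vertices (Suc 2) 2) ({vedge 2 1} \<union> {hedge 1 2, hedge 2 1} \<union> rails 2)"
    by (rule conn) simp_all
qed

lemma double_link_edge:
  "e \<in> S_edges (Suc n) n \<Longrightarrow> double_link n {e} (S_edges (Suc n) n - {e})"
proof (induction n arbitrary: e)
  case 0
  then show ?case by (cases rule: S_edges_cases) auto
next
  case (Suc k)
  define m where "m = Suc k"
  have base: "double_link m {e} (S_edges (Suc m) m - {e})" if "e \<in> S_edges (Suc k) k" for e
    unfolding m_def by (rule double_link_extend[OF Suc.IH[OF that] that])
  have "e \<in> S_edges (Suc m) m" using Suc.prems by (simp add: m_def)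
  then have "double_link m {e} (S_edges (Suc m) m - {e})"
  proof (cases rule: S_edges_cases)
    case (hedge x y)
    show ?thesis
    proof (cases "k = 0")
      case True
      \<comment> \<open>The board of size 0 has no edge to extend, so the induction really starts at
        size 1.\<close>
      then show ?thesis using double_link_1 hedge by (simp add: m_def numeral_2_eq_2)
    next
      case False
      have lower: "double_link m {hedge x y} (S_edges (Suc m) m - {hedge x y})" if "1 \<le> y" "y \<le> k" for y
      proof (cases "x \<le> k")
        case True
        then show ?thesis using that hedge by (intro base) simp
      next
        \<comment> \<open>Only \<open>x = m\<close> remains, whose mirror image is the first
          horizontal edge of the row.\<close>
        case x: False
        have "double_link m {reflect_x m ` hedge 1 y} (S_edges (Suc m) m - {reflect_x m ` hedge 1 y})"
          using that False by (intro double_link_reflect_x base) (auto simp: m_def)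
        moreover have "reflect_x m ` hedge 1 y = hedge x y"
          using x hedge by (simp add: reflect_x_hedge m_def)
        ultimately show ?thesis by simp
      qed
      show ?thesis
      proof (cases "y \<le> k")
        case True
        then show ?thesis using lower hedge by simp
      next
        \<comment> \<open>Only the top row remains; its mirror image, row 1, meets the small board
          because \<open>k\<close> is not 0.\<close>
        case y: False
        have "double_link m {reflect_y m ` hedge x 1} (S_edges (Suc m) m - {reflect_y m ` hedge x 1})"
          using hedge False by (intro double_link_reflect_y lower) (auto simp: m_def)
        moreover have "reflect_y m ` hedge x 1 = e"
          using y hedge by (simp add: reflect_y_hedge m_def)
        ultimately show ?thesis by simp
      qed
    qed
  next
    case (vedge x y)
    have lower: "double_link m {vedge x y} (S_edges (Suc m) m - {vedge x y})" if "1 \<le> y" "y < k" for y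
    proof (cases "x \<le> k")
      case True
      then show ?thesis using that vedge by (intro base) simp
    next
      \<comment> \<open>Here \<open>x = m\<close> is the last inner column; its mirror image is
        column 2, the first inner one.\<close>
      case x: False
      have "double_link m {reflect_x m ` vedge 2 y} (S_edges (Suc m) m - {reflect_x m ` vedge 2 y})"
        using that by (intro double_link_reflect_x base) (auto simp: m_def)
      moreover have "reflect_x m ` vedge 2 y = vedge x y"
        using x vedge by (simp add: reflect_x_vedge m_def)
      ultimately show ?thesis by simp
    qed
    \<comment> \<open>A topmost vertical edge is reflected to the bottom, except for
      \<open>k = 1\<close>: there it is its own mirror image and the small board has no vertical
      edge.\<close>
    consider "y < k" | "y = k" "k = 1" | "y = k" "2 \<le> k" using vedge by (auto simp: m_def) linarith
    then show ?thesis
    proof cases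
      case 1
      then show ?thesis using lower vedge by simp
    next
      case 2
      then have "x = 2" "m = 2" using vedge by (auto simp: m_def)
      then show ?thesis using double_link_2 2 vedge(1) by simp
    next
      case 3
      have "double_link m {reflect_y m ` vedge x 1} (S_edges (Suc m) m - {reflect_y m ` vedge x 1})"
        using vedge 3 by (intro double_link_reflect_y lower) (auto simp: m_def)
      moreover have "reflect_y m ` vedge x 1 = e"
        using 3 vedge by (simp add: reflect_y_vedge m_def)
      ultimately show ?thesis by simp
    qed
  qed
  then show ?case by (simp add: m_def)
qed


section \<open>Maker's reply to a move of Breaker\<close>

text \<open>Since \<open>f\<close> is not in \<open>B\<close>, the second graph survives the loss of
  \<open>f\<close> from \<open>X\<close>. If the first one breaks, \<open>connects_exchange\<close>
  repairs it with an edge of the second; otherwise any remaining edge will do. The first alternative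
  of the conclusion covers the case that none remains.\<close>

lemma double_link_respond_aux:
  assumes AB: "A \<inter> B = {}" "A \<subseteq> X" "B \<subseteq> X" and f: "f \<notin> B"
    and C: "C \<subseteq> S_edges (Suc n) n" and X: "X \<subseteq> S_edges (Suc n) n"
    and conn: "connects (grid_vertices (Suc n) n) (C \<union> A \<union> rails n)"
     "connects (grid_vertices (Suc n) n) (C \<union> B \<union> rails n)"
  shows "connects (grid_vertices (Suc n) n) (C \<union> rails n) \<or>
    (\<exists>g\<in>X - {f}. double_link n (insert g C) (X - {f, g}))"
proof -
  let ?V = "grid_vertices (Suc n) n"
  \<comment> \<open>Only the first graph has to be checked: moving \<open>g\<close> from
    \<open>B\<close> to the claimed edges loses nothing in the second.\<close>
  have reply: "\<exists>g\<in>X - {f}. double_link n (insert g C) (X - {f, g})"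
    if g: "g \<in> X - {f}" and conn': "connects ?V (insert g C \<union> (A - {f}) \<union> rails n)" for g
  proof
    show "double_link n (insert g C) (X - {f, g})"
    proof (rule double_linkI)
      show "(A - {f, g}) \<inter> (B - {g}) = {}" "A - {f, g} \<subseteq> X - {f, g}" "B - {g} \<subseteq> X - {f, g}"
        using AB f by auto
      show "connects ?V (insert g C \<union> (A - {f, g}) \<union> rails n)"
        by (rule connects_mono[OF conn']) auto
      show "connects ?V (insert g C \<union> (B - {g}) \<union> rails n)"
        by (rule connects_mono[OF conn(2)]) auto
    qed
  qed (rule g)
  show ?thesis
  proof (cases "connects ?V (C \<union> (A - {f}) \<union> rails n)")
    case True
    show ?thesis
    proof (cases "X - {f} = {}")
      case True
      \<comment> \<open>With nothing left to claim, the second graph consists of claimed edges and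
        rails alone.\<close>
      then have "B = {}" using AB f by auto
      then show ?thesis using conn(2) by simp
    next
      case False
      then obtain g where g: "g \<in> X - {f}" by auto
      have "connects ?V (insert g C \<union> (A - {f}) \<union> rails n)"
        by (rule connects_mono[OF True]) auto
      from reply[OF g this] show ?thesis ..
    qed
  next
    case False
    let ?F = "C \<union> A \<union> rails n"
    have "\<not> connects ?V (?F - {f})"
    proof
      assume "connects ?V (?F - {f})"
      then have "connects ?V (C \<union> (A - {f}) \<union> rails n)" by (rule connects_mono) auto
      with False show False ..
    qed
    moreover have "C \<union> B \<union> rails n \<subseteq> Pow ?V"
      using AB C X S_edges_subset_Pow[of "Suc n" n] rails_subset_Pow[of n] by blast
    ultimately obtain g where g: "g \<in> C \<union> B \<union> rails n"
      and conn': "connects ?V (insert g (?F - {f}))"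
      using connects_exchange[OF conn] by metis
    \<comment> \<open>An edge already claimed or free would repair nothing, so \<open>g\<close>
      comes from \<open>B\<close> and Maker may claim it.\<close>
    have "g \<notin> C \<union> rails n"
    proof
      assume "g \<in> C \<union> rails n"
      then have "connects ?V (C \<union> (A - {f}) \<union> rails n)"
        by (intro connects_mono[OF conn']) auto
      with False show False ..
    qed
    with g f AB have "g \<in> X - {f}" by auto
    moreover have "connects ?V (insert g C \<union> (A - {f}) \<union> rails n)"
      by (rule connects_mono[OF conn']) auto
    ultimately have "\<exists>g\<in>X - {f}. double_link n (insert g C) (X - {f, g})" by (rule reply)
    then show ?thesis ..
  qed
qed

text \<open>\<open>f\<close> lies in at most one of the disjoint sets, and their roles are
  interchangeable.\<close>

lemma double_link_respond:
  assumes "double_link n C X" and C: "C \<subseteq> S_edges (Suc n) n" and X: "X \<subseteq> S_edges (Suc n) n"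
  shows "connects (grid_vertices (Suc n) n) (C \<union> rails n) \<or>
    (\<exists>g\<in>X - {f}. double_link n (insert g C) (X - {f, g}))"
proof -
  let ?V = "grid_vertices (Suc n) n"
  obtain A B where AB: "A \<inter> B = {}" "A \<subseteq> X" "B \<subseteq> X"
    "connects ?V (C \<union> A \<union> rails n)" "connects ?V (C \<union> B \<union> rails n)"
    using assms(1) unfolding double_link_def by (elim exE conjE)
  show ?thesis
  proof (cases "f \<in> B")
    case False
    then show ?thesis using AB C X by (intro double_link_respond_aux)
  next
    case True
    then have "B \<inter> A = {}" "f \<notin> A" using AB by auto
    then show ?thesis using AB C X by (intro double_link_respond_aux[of B A])
  qed
qed

section \<open>From connectivity to a crossing path\<close>

lemma path_edges_append_single:
  assumes "p \<noteq> []"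
  shows "path_edges (p @ [v]) = insert {last p, v} (path_edges p)"
proof -
  have "path_edges (p @ [v]) = {{(p @ [v]) ! i, (p @ [v]) ! Suc i} | i. Suc i < Suc (length p)}"
    by (simp add: path_edges_def)
  also have "\<dots> = (\<lambda>i. {(p @ [v]) ! i, (p @ [v]) ! Suc i}) ` {i. Suc i < Suc (length p)}" by blast
  also have "{i. Suc i < Suc (length p)} = insert (length p - 1) {i. Suc i < length p}"
    using assms by (cases p) auto
  also have "(\<lambda>i. {(p @ [v]) ! i, (p @ [v]) ! Suc i}) ` \<dots> =
     insert {last p, v} ((\<lambda>i. {p ! i, p ! Suc i}) ` {i. Suc i < length p})"
    using assms by (auto simp: nth_append last_conv_nth)
  also have "(\<lambda>i. {p ! i, p ! Suc i}) ` {i. Suc i < length p} = path_edges p"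
    unfolding path_edges_def by blast
  finally show ?thesis .
qed

lemma path_edges_take: "path_edges (take k p) \<subseteq> path_edges p"
proof
  fix d assume "d \<in> path_edges (take k p)"
  then obtain i where "d = {take k p ! i, take k p ! Suc i}" "Suc i < length (take k p)"
    unfolding path_edges_def by blast
  then have "d = {p ! i, p ! Suc i}" "Suc i < length p" by auto
  then show "d \<in> path_edges p" unfolding path_edges_def by blast
qed

text \<open>A crossing path must not repeat vertices: when the next vertex has been visited before,
  the path is cut back to that visit.\<close>

lemma simple_path_of_rtrancl:
  assumes "(u, w) \<in> {(a, b). {a, b} \<in> M}\<^sup>*" "M \<subseteq> Pow V" "u \<in> V"
  shows "\<exists>p. p \<noteq> [] \<and> distinct p \<and> set p \<subseteq> V \<and> path_edges p \<subseteq> M \<and> hd p = u \<and> last p = w"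
  using assms(1)
proof (induction rule: rtrancl_induct)
  case base
  show ?case using assms(3) by (intro exI[of _ "[u]"]) (simp add: path_edges_def)
next
  case (step w z)
  then obtain p where p: "p \<noteq> []" "distinct p" "set p \<subseteq> V" "path_edges p \<subseteq> M" "hd p = u" "last p = w"
    by blast
  have wz: "{w, z} \<in> M" using step.hyps(2) by simp
  show ?case
  proof (cases "z \<in> set p")
    case False
    have "z \<in> V" using wz assms(2) by auto
    with False p wz show ?thesis
      by (intro exI[of _ "p @ [z]"]) (simp add: path_edges_append_single)
  next
    case True
    then obtain k where k: "k < length p" "p ! k = z" by (auto simp: in_set_conv_nth)
    have "last (take (Suc k) p) = z" using k by (simp add: take_Suc_conv_app_nth)
    moreover have "set (take (Suc k) p) \<subseteq> V" using p(3) set_take_subset[of "Suc k" p] by auto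
    moreover have "path_edges (take (Suc k) p) \<subseteq> M" using path_edges_take[of "Suc k" p] p(4) by auto
    ultimately show ?thesis using p
      by (intro exI[of _ "take (Suc k) p"]) simp
  qed
qed

text \<open>Colour the vertices by reachability from the left column inside \<open>M\<close>. If no
  vertex of the right column were reached, the colouring would be constant along \<open>M\<close>
  and along both rails but would differ between the sides.\<close>

lemma crossing_path_if_connects:
  assumes conn: "connects (grid_vertices (Suc n) n) (M \<union> rails n)"
    and M: "M \<subseteq> S_edges (Suc n) n" and n: "1 \<le> n"
  shows "\<exists>p. crossing_path (Suc n) n p \<and> path_edges p \<subseteq> M"
proof -
  let ?V = "grid_vertices (Suc n) n" and ?R = "{(a, b). {a, b} \<in> M}\<^sup>*"
  define c where "c w \<longleftrightarrow> (\<exists>u\<in>?V. fst u = 1 \<and> (u, w) \<in> ?R)" for w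
  have "\<exists>w\<in>?V. fst w = Suc n \<and> c w"
  proof (rule ccontr)
    assume "\<not> ?thesis"
    then have right: "\<not> c w" if "w \<in> ?V" "fst w = Suc n" for w using that by blast
    have left: "c w" if "w \<in> ?V" "fst w = 1" for w using that unfolding c_def by blast
    have fwd: "c v" if "c u" "{u, v} \<in> M" for u v
      using that unfolding c_def by (auto intro: rtrancl_into_rtrancl)
    have "c (1, 1) = c (Suc n, 1)"
    proof (rule connectsD[OF conn])
      fix u v assume uv: "{u, v} \<in> M \<union> rails n"
      show "c u = c v"
      proof (cases "{u, v} \<in> M")
        case True
        then have "{v, u} \<in> M" by (simp add: insert_commute)
        then show ?thesis using True fwd by blast
      next
        case False
        then have r: "{u, v} \<in> rails n" using uv by simp
        then have "{u, v} \<in> Pow ?V" using rails_subset_Pow by (rule subsetD[rotated])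
        then have "u \<in> ?V" "v \<in> ?V" by simp_all
        moreover from r have "fst u = 1 \<and> fst v = 1 \<or> fst u = Suc n \<and> fst v = Suc n"
          by (auto simp: rails_def vedge_def doubleton_eq_iff)
        ultimately show ?thesis using left right by blast
      qed
    qed (use n in \<open>auto simp: grid_vertices_def\<close>)
    then show False using left[of "(1, 1)"] right[of "(Suc n, 1)"] n
      by (simp add: grid_vertices_def)
  qed
  then obtain u w where uw: "u \<in> ?V" "fst u = 1" "fst w = Suc n" "(u, w) \<in> ?R"
    unfolding c_def by blast
  have "M \<subseteq> Pow ?V" using M S_edges_subset_Pow by (rule subset_trans)
  from simple_path_of_rtrancl[OF uw(4) this uw(1)] show ?thesis
    using uw M unfolding crossing_path_def by (metis subset_trans)
qed

section \<open>The strategy along a play\<close>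

lemma maker_edges_append_single:
  "maker_edges (h @ [x]) = (if even (length h) then insert x (maker_edges h) else maker_edges h)"
proof -
  have *: "maker_edges xs = (!) xs ` {i. i < length xs \<and> even i}" for xs
    unfolding maker_edges_def by blast
  have "{i. i < length (h @ [x]) \<and> even i} =
     (if even (length h) then insert (length h) {i. i < length h \<and> even i} else {i. i < length h \<and> even i})"
    by (auto simp: less_Suc_eq)
  moreover have "(!) (h @ [x]) ` {i. i < length h \<and> even i} = (!) h ` {i. i < length h \<and> even i}"
    by (rule image_cong) (auto simp: nth_append)
  ultimately show ?thesis unfolding * by simp
qed

lemma maker_edges_subset: "maker_edges h \<subseteq> set h"
  unfolding maker_edges_def by auto

text \<open>Odd length means that Breaker is to move.\<close>

definition maker_safe :: "nat \<Rightarrow> edge list \<Rightarrow> bool" where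
  "maker_safe n h \<longleftrightarrow> odd (length h) \<and> claim_sequence (Suc n) n h \<and>
     double_link n (maker_edges h) (S_edges (Suc n) n - set h)"

lemma maker_won_if_connects:
  assumes "claim_sequence (Suc n) n h" "h \<noteq> []"
    "connects (grid_vertices (Suc n) n) (maker_edges h \<union> rails n)"
  shows "maker_won (Suc n) n h"
proof -
  have S: "set h \<subseteq> S_edges (Suc n) n" using assms(1) by (simp add: claim_sequence_def)
  \<comment> \<open>A claimed edge exists, so the board is not empty.\<close>
  have "hd h \<in> S_edges (Suc n) n" using S hd_in_set[OF assms(2)] by (rule subsetD)
  then have "1 \<le> n" by (cases rule: S_edges_cases) auto
  moreover have "maker_edges h \<subseteq> S_edges (Suc n) n" using maker_edges_subset S by (rule subset_trans)
  ultimately show ?thesis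
    unfolding maker_won_def using assms(3) by (intro crossing_path_if_connects)
qed

text \<open>One round of the game. As Maker has not won, her edges and the rails do not connect
  everything, which leaves only the second alternative of
  \<open>double_link_respond\<close>.\<close>

lemma maker_safe_respond:
  assumes h: "maker_safe n h" and f: "f \<in> S_edges (Suc n) n - set h"
    and nw: "\<not> maker_won (Suc n) n (h @ [f])"
  shows "\<exists>g. g \<in> S_edges (Suc n) n - set (h @ [f]) \<and> maker_safe n (h @ [f, g])"
proof -
  let ?S = "S_edges (Suc n) n"
  have odd: "odd (length h)" and cs: "claim_sequence (Suc n) n h"
    and link: "double_link n (maker_edges h) (?S - set h)"
    using h by (simp_all add: maker_safe_def)
  have M: "maker_edges (h @ [f]) = maker_edges h"
    using odd by (simp add: maker_edges_append_single)
  have M2: "maker_edges (h @ [f, g]) = insert g (maker_edges h)" for g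
    using odd maker_edges_append_single[of "h @ [f]" g] M by simp
  have csf: "claim_sequence (Suc n) n (h @ [f])"
    using cs f by (simp add: claim_sequence_def)
  then have "\<not> connects (grid_vertices (Suc n) n) (maker_edges h \<union> rails n)"
    using nw maker_won_if_connects[of n "h @ [f]"] M by auto
  moreover have "maker_edges h \<subseteq> ?S"
    using maker_edges_subset cs by (auto simp: claim_sequence_def)
  ultimately obtain g where g: "g \<in> ?S - set h - {f}"
    and link': "double_link n (insert g (maker_edges h)) (?S - set h - {f, g})"
    using double_link_respond[OF link, of f] by auto
  have "?S - set h - {f, g} = ?S - set (h @ [f, g])" by auto
  then have "maker_safe n (h @ [f, g])"
    using odd link' g f cs M2[of g] by (auto simp: maker_safe_def claim_sequence_def)
  then show ?thesis using g by auto
qed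

text \<open>Serves to refute \<open>breaker_won\<close>, for which one favourable continuation
  suffices: let Breaker claim arbitrary edges and Maker reply safely, until she wins or no edge is
  left.\<close>

lemma maker_safe_continuation:
  "maker_safe n h \<Longrightarrow> \<exists>h'. claim_sequence (Suc n) n (h @ h') \<and> maker_won (Suc n) n (h @ h')"
proof (induction "card (S_edges (Suc n) n - set h)" arbitrary: h rule: less_induct)
  case less
  let ?S = "S_edges (Suc n) n"
  have odd: "odd (length h)" and cs: "claim_sequence (Suc n) n h"
    and link: "double_link n (maker_edges h) (?S - set h)"
    using less.prems by (simp_all add: maker_safe_def)
  show ?case
  proof (cases "?S - set h = {}")
    case True
    \<comment> \<open>Without unclaimed edges, \<open>A\<close> and \<open>B\<close> are
      empty.\<close>
    have "connects (grid_vertices (Suc n) n) (maker_edges h \<union> rails n)"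
      using link unfolding True double_link_def by auto
    then have "maker_won (Suc n) n h" using odd by (intro maker_won_if_connects[OF cs]) auto
    then show ?thesis using cs by (intro exI[of _ "[]"]) simp
  next
    case False
    then obtain f where f: "f \<in> ?S - set h" by auto
    show ?thesis
    proof (cases "maker_won (Suc n) n (h @ [f])")
      case True
      then show ?thesis using cs f by (intro exI[of _ "[f]"]) (simp add: claim_sequence_def)
    next
      case False
      obtain g where g: "maker_safe n (h @ [f, g])"
        using maker_safe_respond[OF less.prems f False] by auto
      have "card (?S - set (h @ [f, g])) < card (?S - set h)"
        using f by (intro psubset_card_mono) (auto simp: finite_S_edges)
      from less.hyps[OF this g] obtain h' where
        "claim_sequence (Suc n) n ((h @ [f, g]) @ h')" "maker_won (Suc n) n ((h @ [f, g]) @ h')" by auto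
      then show ?thesis by (intro exI[of _ "f # g # h'"]) simp
    qed
  qed
qed

lemma play_following_append_singleD:
  assumes "play_following m n \<sigma> (h @ [x])"
  shows "play_following m n \<sigma> h" "\<not> game_over m n h" "x \<in> S_edges m n - set h"
    "even (length h) \<Longrightarrow> x = \<sigma> h"
proof -
  have p: "play m n (h @ [x])"
    and s: "\<And>i. i < Suc (length h) \<Longrightarrow> even i \<Longrightarrow> (h @ [x]) ! i = \<sigma> (take i (h @ [x]))"
    using assms by (auto simp: play_following_def)
  then have cs: "claim_sequence m n (h @ [x])"
    and over: "\<And>i. i < Suc (length h) \<Longrightarrow> \<not> game_over m n (take i (h @ [x]))"
    by (auto simp: play_def)
  show "x \<in> S_edges m n - set h" using cs by (simp add: claim_sequence_def)
  show "\<not> game_over m n h" using over[of "length h"] by simp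
  show "x = \<sigma> h" if "even (length h)" using s[of "length h"] that by simp
  have "claim_sequence m n h" using cs by (simp add: claim_sequence_def)
  moreover have "\<not> game_over m n (take i h)" if "i < length h" for i
    using over[of i] that by simp
  moreover have "h ! i = \<sigma> (take i h)" if "i < length h" "even i" for i
    using s[of i] that by (simp add: nth_append)
  ultimately show "play_following m n \<sigma> h" by (simp add: play_following_def play_def)
qed

text \<open>After the opening move, \<open>SOME\<close> picks a reply that restores
  \<open>maker_safe\<close>. Such a reply exists by \<open>maker_safe_respond\<close> if the
  position before Breaker's last legal move was safe and Maker has not won; otherwise the value may
  be arbitrary.\<close>

definition safe_strategy :: "nat \<Rightarrow> edge \<Rightarrow> strategy" where
  "safe_strategy n e h =
     (if h = [] then e
      else SOME g. g \<in> S_edges (Suc n) n - set h \<and> maker_safe n (h @ [g]))"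

lemma safe_strategy_step:
  assumes "maker_safe n (butlast h)" "h \<noteq> []" "last h \<in> S_edges (Suc n) n - set (butlast h)"
    "\<not> maker_won (Suc n) n h"
  shows "safe_strategy n e h \<in> S_edges (Suc n) n - set h \<and> maker_safe n (h @ [safe_strategy n e h])"
proof -
  have h: "butlast h @ [last h] = h" using assms(2) by simp
  then have h2: "butlast h @ [last h, g] = h @ [g]" for g
    by (metis append.assoc append_Cons append_Nil)
  have "\<exists>g. g \<in> S_edges (Suc n) n - set h \<and> maker_safe n (h @ [g])"
    using maker_safe_respond[OF assms(1,3)] assms(4) unfolding h h2 .
  from someI_ex[OF this] show ?thesis using assms(2) by (simp add: safe_strategy_def)
qed

lemma maker_safe_initial:
  assumes "e \<in> S_edges (Suc n) n"
  shows "maker_safe n [e]"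
  using assms double_link_edge[OF assms] maker_edges_append_single[of "[]" e]
  by (simp add: maker_safe_def claim_sequence_def maker_edges_def)

text \<open>The invariant belongs to positions with Breaker to move; at Maker's turn it is recorded
  for the position before Breaker's latest edge.\<close>

lemma safe_strategy_play:
  assumes e: "e \<in> S_edges (Suc n) n"
  shows "play_following (Suc n) n (safe_strategy n e) h \<Longrightarrow> h \<noteq> [] \<Longrightarrow>
    maker_safe n (if odd (length h) then h else butlast h)"
proof (induction h rule: rev_induct)
  case (snoc x h)
  note D = play_following_append_singleD[OF snoc.prems(1)]
  show ?case
  proof (cases "h = []")
    case True
    then show ?thesis using D(4) maker_safe_initial[OF e] by (simp add: safe_strategy_def)
  next
    case False
    note IH = snoc.IH[OF D(1) False]
    show ?thesis
    proof (cases "odd (length h)")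
      case True
      then show ?thesis using IH by simp
    next
      case even: False
      have "play_following (Suc n) n (safe_strategy n e) (butlast h @ [last h])"
        using D(1) False by simp
      then have "last h \<in> S_edges (Suc n) n - set (butlast h)"
        by (rule play_following_append_singleD)
      then have "maker_safe n (h @ [safe_strategy n e h])"
        using IH even False D(2) safe_strategy_step[of n h e] by (simp add: game_over_def)
      then show ?thesis using D(4) even by simp
    qed
  qed
qed simp

lemma safe_strategy_legal:
  assumes e: "e \<in> S_edges (Suc n) n" and play: "play_following (Suc n) n (safe_strategy n e) h"
    and nw: "\<not> maker_won (Suc n) n h" and even: "even (length h)"
  shows "safe_strategy n e h \<in> S_edges (Suc n) n - set h \<and> maker_safe n (h @ [safe_strategy n e h])"
proof (cases "h = []")
  case True
  then show ?thesis using e maker_safe_initial[OF e] by (simp add: safe_strategy_def)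
next
  case False
  have "play_following (Suc n) n (safe_strategy n e) (butlast h @ [last h])"
    using play False by simp
  then have "last h \<in> S_edges (Suc n) n - set (butlast h)"
    by (rule play_following_append_singleD)
  then show ?thesis
    using safe_strategy_play[OF e play False] even nw False by (intro safe_strategy_step) simp_all
qed

text \<open>A safe position, reached by Maker's next move if it is her turn, has a winning
  continuation, which also continues \<open>h\<close>. Hence a play that is over has been won by
  Maker.\<close>

lemma safe_strategy_not_breaker_won:
  assumes e: "e \<in> S_edges (Suc n) n" and play: "play_following (Suc n) n (safe_strategy n e) h"
    and nw: "\<not> maker_won (Suc n) n h"
  shows "\<not> breaker_won (Suc n) n h"
proof (cases "even (length h)")
  case True
  from safe_strategy_legal[OF e play nw True]
  have "maker_safe n (h @ [safe_strategy n e h])" ..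
  from maker_safe_continuation[OF this] show ?thesis
    unfolding breaker_won_def by (metis append_assoc)
next
  case False
  then have "maker_safe n h" using safe_strategy_play[OF e play] by (cases "h = []") simp_all
  from maker_safe_continuation[OF this] show ?thesis
    unfolding breaker_won_def by (metis append_assoc)
qed

theorem theorem2p7:
  fixes n :: nat and e :: edge
  assumes "e \<in> S_edges (n + 1) n"
  shows "\<exists>\<sigma>. maker_winning_strategy (n + 1) n \<sigma> \<and> \<sigma> [] = e"
proof (intro exI conjI)
  have e: "e \<in> S_edges (Suc n) n" using assms by simp
  show "safe_strategy n e [] = e" by (simp add: safe_strategy_def)
  show "maker_winning_strategy (n + 1) n (safe_strategy n e)"
    unfolding maker_winning_strategy_def game_over_def Suc_eq_plus1[symmetric]
    using safe_strategy_legal[OF e] safe_strategy_not_breaker_won[OF e] by blast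
qed

end
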